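(* (a) Let $d\in\mathbb N$, $\beta>0$, $\alpha\le0$ and $a>0$. The rate function $I^{\mathrm{CMF}}_\alpha$ has a unique zero at $\xi^{\mathrm{CMF}}\in\ell_1(\mathbb R)$ given by $$\xi^{\mathrm{CMF}}_k=\frac{W_0(a\beta\bar q^{(\alpha)})}{a\beta\bar q^{(\alpha)}}\,q_k^{(\alpha)},\qquad k\in\mathbb N,$$ where $W_0$ is the real branch of the Lambert $W$ function for non-negative arguments. (b) Let $\beta>0$, $\alpha\le0$ and $a\ge0$. Then $$p^{\mathrm{CMF}}(\beta,\alpha)=\lim_{N\to\infty}\frac1{\beta|\Lambda_N|}\log Z_N^{\mathrm{CMF}}(\beta,\alpha)=\frac1{a\beta^2}W_0(a\beta\bar q^{(\alpha)})\Big(1+\frac12W_0(a\beta\bar q^{(\alpha)})\Big).$$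
   Context: $|\Lambda_N|=(2N)^d$ for $d,N\in\mathbb N=\{1,2,\dots\}$; $q_k^{(\alpha)}=\frac{e^{\beta k\alpha}}{(4\pi\beta)^{d/2}k^{1+d/2}}$ and $\bar q^{(\alpha)}=\sum_{k\in\mathbb N}q_k^{(\alpha)}$. $\ell_1(\mathbb R)$ is the space of absolutely summable real sequences and $\ell_1(\mathbb R_+)$ its subset of nonnegative sequences. Let $(\mathcal N_k)_{k\in\mathbb N}$ be independent Poisson random variables, $\mathcal N_k$ having parameter $|\Lambda_N|q_k^{(\alpha)}$; $\nu_{N,\alpha}$ is the law on $\ell_1(\mathbb R_+)$ of $(\mathcal N_k/|\Lambda_N|)_{k\in\mathbb N}$. Define $$I_\alpha(x)=\sum_{k=1}^\infty\frac{x_k}{\beta}\Big(\log\frac{x_k}{q_k^{(\alpha)}}-1\Big)+\frac{\bar q^{(\alpha)}}{\beta}\quad(x\in\ell_1(\mathbb R_+),\ 0\log0=0),$$ with $I_\alpha(x)=+\infty$ for $x\in\ell_1(\mathbb R)\setminus\ell_1(\mathbb R_+)$, and $$H^{\mathrm{CMF}}(x)=\frac a2\Big(\sum_{k=1}^\infty x_k\Big)^2,\qquad Z_N^{\mathrm{CMF}}(\beta,\alpha)=\mathbb E_{\nu_{N,\alpha}}\big[e^{-\beta|\Lambda_N|H^{\mathrm{CMF}}}\big].$$ The rate function of the cycle-mean-field (CMF) model is $$I^{\mathrm{CMF}}_\alpha(x)=H^{\mathrm{CMF}}(x)+I_\alpha(x)-\inf_{y\in\ell_1(\mathbb R)}\{H^{\mathrm{CMF}}(y)+I_\alpha(y)\}.$$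 $W_0$ is determined on $[0,\infty)$ by $W_0(x)e^{W_0(x)}=x$, $W_0(x)\ge0$.
   Formalization: In (b), since Z_N is an expectation of values ≤ 1 under a probability measure, the pressure is ≤ 0 while the printed formula is > 0; what is proved is q̄/β + p^CMF = the printed formula for a > 0, and at a = 0 (where it reads 0/0) with the formula replaced by its limit as a → 0+. *)

theory Defs
  imports "HOL-Probability.Probability"
begin

text \<open>
  Sequences are indexed by the positive integers: they are functions on \<^term>\<open>{1::nat..}\<close>, extensional
  so that equality of sequences is equality of functions (the value at index 0 carries no
  information). A series over the positive integers is written \<open>\<Sum>k. f (Suc k)\<close>.
\<close>

definition ell1 :: "(nat \<Rightarrow> real) set" where
  "ell1 = {x \<in> extensional {1..}. summable (\<lambda>k. \<bar>x (Suc k)\<bar>)}"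

definition ell1_nonneg :: "(nat \<Rightarrow> real) set" where
  "ell1_nonneg = {x \<in> ell1. \<forall>k\<ge>1. 0 \<le> x k}"

definition vol :: "nat \<Rightarrow> nat \<Rightarrow> real" where
  "vol d N = (2 * real N) ^ d"

definition q :: "nat \<Rightarrow> real \<Rightarrow> real \<Rightarrow> nat \<Rightarrow> real" where
  "q d \<beta> \<alpha> k =
     exp (\<beta> * real k * \<alpha>) / ((4 * pi * \<beta>) powr (real d / 2) * real k powr (1 + real d / 2))"

definition qbar :: "nat \<Rightarrow> real \<Rightarrow> real \<Rightarrow> real" where
  "qbar d \<beta> \<alpha> = (\<Sum>k. q d \<beta> \<alpha> (Suc k))"

definition poisson_family :: "nat \<Rightarrow> real \<Rightarrow> real \<Rightarrow> nat \<Rightarrow> (nat \<Rightarrow> nat) measure" where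
  "poisson_family d \<beta> \<alpha> N =
     PiM {1..} (\<lambda>k. measure_pmf (poisson_pmf (vol d N * q d \<beta> \<alpha> k)))"

definition scaled_counts :: "nat \<Rightarrow> nat \<Rightarrow> (nat \<Rightarrow> nat) \<Rightarrow> nat \<Rightarrow> real" where
  "scaled_counts d N n = (\<lambda>k\<in>{1..}. real (n k) / vol d N)"

text \<open>
  The law of the scaled Poisson counts on the nonnegative cone of \<open>\<ell>\<^sub>1\<close>. The scaled counts are
  summable almost surely, since the Poisson parameters are summable; on the exceptional null set
  they are replaced by the zero sequence, so that the map takes values in \<^const>\<open>ell1_nonneg\<close>.
  The sigma-algebra is the trace of the product sigma-algebra, which is the Borel sigma-algebra
  of the \<open>\<ell>\<^sub>1\<close>-norm, because \<open>\<ell>\<^sub>1\<close> is separable and its norm is a supremum of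
  finite sums of absolute values of coordinates.
\<close>

definition \<nu> :: "nat \<Rightarrow> real \<Rightarrow> real \<Rightarrow> nat \<Rightarrow> (nat \<Rightarrow> real) measure" where
  "\<nu> d \<beta> \<alpha> N =
     distr (poisson_family d \<beta> \<alpha> N) (restrict_space (PiM {1..} (\<lambda>_. borel)) ell1_nonneg)
       (\<lambda>n. if scaled_counts d N n \<in> ell1_nonneg then scaled_counts d N n else (\<lambda>k\<in>{1..}. 0))"

text \<open>
  Each summand of the series below is at least \<open>- q\<^sub>k / \<beta>\<close>, so for \<open>\<beta> > 0\<close> and
  \<open>\<alpha> \<le> 0\<close> the partial sums converge in the extended reals, possibly to \<open>\<infinity>\<close>.
  The convention \<open>0 log 0 = 0\<close> holds because the logarithm is multiplied by \<open>x\<^sub>k = 0\<close>.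
\<close>

definition I :: "nat \<Rightarrow> real \<Rightarrow> real \<Rightarrow> (nat \<Rightarrow> real) \<Rightarrow> ereal" where
  "I d \<beta> \<alpha> x =
     (if x \<in> ell1_nonneg
      then (\<Sum>k. ereal (x (Suc k) / \<beta> * (ln (x (Suc k) / q d \<beta> \<alpha> (Suc k)) - 1)))
             + ereal (qbar d \<beta> \<alpha> / \<beta>)
      else \<infinity>)"

definition H_CMF :: "real \<Rightarrow> (nat \<Rightarrow> real) \<Rightarrow> real" where
  "H_CMF a x = a / 2 * (\<Sum>k. x (Suc k))\<^sup>2"

definition I_CMF :: "nat \<Rightarrow> real \<Rightarrow> real \<Rightarrow> real \<Rightarrow> (nat \<Rightarrow> real) \<Rightarrow> ereal" where
  "I_CMF d \<beta> \<alpha> a x =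
     ereal (H_CMF a x) + I d \<beta> \<alpha> x - (INF y\<in>ell1. ereal (H_CMF a y) + I d \<beta> \<alpha> y)"

definition Z_CMF :: "nat \<Rightarrow> real \<Rightarrow> real \<Rightarrow> real \<Rightarrow> nat \<Rightarrow> real" where
  "Z_CMF d \<beta> \<alpha> a N = (LINT x|\<nu> d \<beta> \<alpha> N. exp (- \<beta> * vol d N * H_CMF a x))"

definition p_CMF_N :: "nat \<Rightarrow> real \<Rightarrow> real \<Rightarrow> real \<Rightarrow> nat \<Rightarrow> real" where
  "p_CMF_N d \<beta> \<alpha> a N = 1 / (\<beta> * vol d N) * ln (Z_CMF d \<beta> \<alpha> a N)"

definition p_CMF :: "nat \<Rightarrow> real \<Rightarrow> real \<Rightarrow> real \<Rightarrow> real" where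
  "p_CMF d \<beta> \<alpha> a = lim (p_CMF_N d \<beta> \<alpha> a)"

definition W0 :: "real \<Rightarrow> real" where
  "W0 x = (THE w. 0 \<le> w \<and> w * exp w = x)"

definition \<xi>_CMF :: "nat \<Rightarrow> real \<Rightarrow> real \<Rightarrow> real \<Rightarrow> nat \<Rightarrow> real" where
  "\<xi>_CMF d \<beta> \<alpha> a =
     (\<lambda>k\<in>{1..}. W0 (a * \<beta> * qbar d \<beta> \<alpha>) / (a * \<beta> * qbar d \<beta> \<alpha>) * q d \<beta> \<alpha> k)"

definition p_CMF_formula :: "nat \<Rightarrow> real \<Rightarrow> real \<Rightarrow> real \<Rightarrow> real" where
  "p_CMF_formula d \<beta> \<alpha> a =
     1 / (a * \<beta>\<^sup>2) * W0 (a * \<beta> * qbar d \<beta> \<alpha>) * (1 + 1 / 2 * W0 (a * \<beta> * qbar d \<beta> \<alpha>))"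

text \<open>
  Normalisation of the pressure. Since \<^const>\<open>Z_CMF\<close> is the expectation of a function with values
  in \<open>(0, 1]\<close> under a probability measure, its logarithm is never positive, so
  \<^const>\<open>p_CMF\<close> cannot equal the positive number \<^const>\<open>p_CMF_formula\<close>: this is
  \<open>p_CMF_N_not_tendsto_formula\<close> below. The closed formula is the pressure belonging to the
  partition function \<open>exp (|\<Lambda>\<^sub>N| qbar) * Z_CMF\<close>, that is, the pressure
  \<open>qbar / \<beta>\<close> of the ideal gas plus \<^const>\<open>p_CMF\<close>.
\<close>

lemma nu_mass_le_1: "emeasure (\<nu> d \<beta> \<alpha> N) (space (\<nu> d \<beta> \<alpha> N)) \<le> 1"
proof -
  interpret P: prob_space "poisson_family d \<beta> \<alpha> N"
    unfolding poisson_family_def by (intro prob_space_PiM prob_space_measure_pmf)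
  show ?thesis
    unfolding \<nu>_def distr_def
    by (subst emeasure_measure_of_conv) (auto intro: P.measure_le_1)
qed

lemma Z_CMF_le_1:
  assumes "\<beta> > 0" "a \<ge> 0"
  shows "0 \<le> Z_CMF d \<beta> \<alpha> a N" "Z_CMF d \<beta> \<alpha> a N \<le> 1"
proof -
  let ?M = "\<nu> d \<beta> \<alpha> N"
  let ?f = "\<lambda>x. exp (- \<beta> * vol d N * H_CMF a x)"
  show "0 \<le> Z_CMF d \<beta> \<alpha> a N" unfolding Z_CMF_def by (rule integral_nonneg_AE) auto
  have f: "?f x \<le> 1" for x
    using assms by (simp add: H_CMF_def vol_def)
  have fin: "emeasure ?M (space ?M) \<noteq> \<infinity>" using nu_mass_le_1[of d \<beta> \<alpha> N] by (auto simp: top_unique)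
  then interpret finite_measure ?M by (rule finite_measureI)
  have m: "measure ?M (space ?M) \<le> 1"
    using nu_mass_le_1[of d \<beta> \<alpha> N] by (simp add: emeasure_eq_measure)
  show "Z_CMF d \<beta> \<alpha> a N \<le> 1"
  proof (cases "integrable ?M ?f")
    case True
    then have "(LINT x|?M. ?f x) \<le> (LINT x|?M. 1)" by (intro integral_mono f) auto
    then show ?thesis using m unfolding Z_CMF_def by simp
  qed (simp add: Z_CMF_def not_integrable_integral_eq)
qed

lemma p_CMF_N_le_0:
  assumes "\<beta> > 0" "a \<ge> 0" shows "p_CMF_N d \<beta> \<alpha> a N \<le> 0"
proof -
  have "ln (Z_CMF d \<beta> \<alpha> a N) \<le> 0"
    using Z_CMF_le_1[OF assms, of d \<alpha> N] by (metis ln_le_zero_iff ln_0 order.order_iff_strict)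
  then show ?thesis using assms unfolding p_CMF_N_def vol_def
    by (intro mult_nonneg_nonpos) auto
qed

lemma q_pos: "\<beta> > 0 \<Longrightarrow> k \<ge> 1 \<Longrightarrow> q d \<beta> \<alpha> k > 0" by (simp add: q_def)

lemma W0_pos: assumes "x > 0" shows "W0 x > 0" "W0 x * exp (W0 x) = x"
proof -
  have "\<exists>w\<ge>0. w \<le> x \<and> w * exp w = x"
    by (rule IVT') (use assms in \<open>auto intro!: continuous_intros\<close>)
  then obtain w where w: "0 \<le> w \<and> w * exp w = x" by blast
  have "u = w" if "0 \<le> u \<and> u * exp u = x" for u
  proof (rule ccontr)
    assume "u \<noteq> w"
    then consider "u < w" | "w < u" by linarith
    then have "u * exp u \<noteq> w * exp w"
    proof cases
      case 1 have "u * exp u < w * exp w" by (rule mult_strict_mono) (use 1 that w in auto)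
      then show ?thesis by simp
    next
      case 2 have "w * exp w < u * exp u" by (rule mult_strict_mono) (use 2 that w in auto)
      then show ?thesis by simp
    qed
    then show False using w that by simp
  qed
  then have "0 \<le> W0 x \<and> W0 x * exp (W0 x) = x"
    unfolding W0_def using w theI[of "\<lambda>w. 0 \<le> w \<and> w * exp w = x" w] by blast
  moreover from this have "W0 x \<noteq> 0" using assms by auto
  ultimately show "W0 x > 0" "W0 x * exp (W0 x) = x" by auto
qed

lemma summable_q: assumes "d \<ge> 1" "\<beta> > 0" "\<alpha> \<le> 0" shows "summable (\<lambda>k. q d \<beta> \<alpha> (Suc k))"
proof -
  let ?c = "(4 * pi * \<beta>) powr (real d / 2)"
  have "summable (\<lambda>k. real k powr (- (1 + real d / 2)))"
    using assms by (subst summable_real_powr_iff) auto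
  then have "summable (\<lambda>k. real (Suc k) powr (- (1 + real d / 2)))" by (subst summable_Suc_iff)
  then have s: "summable (\<lambda>k. 1 / ?c * real (Suc k) powr (- (1 + real d / 2)))" by (rule summable_mult)
  show ?thesis
  proof (rule summable_comparison_test'[OF s, of 0])
    fix k :: nat
    have "exp (\<beta> * real (Suc k) * \<alpha>) \<le> 1" using assms by (simp add: mult_nonneg_nonpos)
    then have "q d \<beta> \<alpha> (Suc k) \<le> 1 / (?c * real (Suc k) powr (1 + real d / 2))"
      unfolding q_def using assms by (intro divide_right_mono) auto
    moreover have "0 \<le> q d \<beta> \<alpha> (Suc k)" by (simp add: q_def)
    ultimately show "norm (q d \<beta> \<alpha> (Suc k)) \<le> 1 / ?c * real (Suc k) powr (- (1 + real d / 2))"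
      unfolding powr_minus_divide by simp
  qed
qed

lemma p_CMF_N_not_tendsto_formula:
  assumes "d \<ge> 1" "\<beta> > 0" "\<alpha> \<le> 0" "a > 0"
  shows "\<not> (p_CMF_N d \<beta> \<alpha> a \<longlonglongrightarrow> p_CMF_formula d \<beta> \<alpha> a)"
proof
  assume "p_CMF_N d \<beta> \<alpha> a \<longlonglongrightarrow> p_CMF_formula d \<beta> \<alpha> a"
  then have "p_CMF_formula d \<beta> \<alpha> a \<le> 0"
    by (rule LIMSEQ_le_const2) (use assms p_CMF_N_le_0 in auto)
  moreover have "qbar d \<beta> \<alpha> > 0" unfolding qbar_def
    by (rule suminf_pos) (use summable_q assms q_pos in auto)
  then have "W0 (a * \<beta> * qbar d \<beta> \<alpha>) > 0" using assms by (intro W0_pos) auto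
  then have "p_CMF_formula d \<beta> \<alpha> a > 0" unfolding p_CMF_formula_def
    using assms by (intro mult_pos_pos) auto
  ultimately show False by simp
qed
end

theory Submission
  imports Defs
begin

text \<open>
  Write \<open>V\<close> for the volume, \<open>Q\<close> for \<open>qbar\<close> and \<open>c = a * \<beta>\<close>. Everything rests on the number
  \<open>t \<ge> 0\<close> with \<open>t = Q * exp (- c * t)\<close>, the equilibrium density. For \<open>a > 0\<close> the
  product \<open>w = c * t\<close> satisfies \<open>w * exp w = c * Q\<close>, so \<open>w\<close> is the value of the Lambert function
  at \<open>c * Q\<close>; for \<open>a = 0\<close> one has \<open>t = Q\<close>.

  The zero of the rate function comes from an exact identity. Put \<open>\<xi> k = exp (- w) * q k\<close>, a
  sequence of total mass \<open>t\<close>. For nonnegative summable \<open>x\<close> of total mass \<open>s\<close>, the energy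
  \<open>H + I\<close> at \<open>x\<close> is a constant plus \<open>a / 2 * (s - t)\<^sup>2\<close> plus \<open>1 / \<beta>\<close> times the sum of the Poisson
  relative entropies of \<open>x k\<close> with respect to \<open>\<xi> k\<close> (\<open>energy_eq_square_plus_relent\<close>). Both
  extra terms are nonnegative, both vanish at \<open>\<xi>\<close>, and the entropies vanish nowhere else.

  For the pressure, the Hamiltonian sees only the total of the counts, and a sum of
  independent Poisson variables with summable rates is Poisson, here
  of mean \<open>V * Q\<close> (\<open>distr_total_count\<close>). So the partition function is the expectation of
  \<open>exp (- c * S\<^sup>2 / (2 * V))\<close> for a single Poisson variable \<open>S\<close>. The tangent to the parabola at
  \<open>V * t\<close> bounds it from above (\<open>poisson_gaussian_upper\<close>); exponential tilting to the mean
  \<open>V * t\<close> followed by Jensen's inequality bounds it from below (\<open>poisson_gaussian_lower\<close>). By the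
  choice of \<open>t\<close> both bounds have the exponent \<open>V * (c * t\<^sup>2 / 2 + t - Q)\<close>, up to a term
  independent of \<open>V\<close>. Dividing by \<open>\<beta> * V\<close> gives the pressure relative to that of the ideal gas,
  \<open>Q / \<beta>\<close>, and substituting \<open>w\<close> turns it into the closed formula.
\<close>

section \<open>Poisson laws: moments, tilting and convolution\<close>

text \<open>
  The recursion \<open>Suc n * p (Suc n) = m * p n\<close> for the Poisson probabilities \<open>p\<close> reduces each
  moment to lower ones.
\<close>
lemma poisson_pmf_sums:
  assumes "m > 0"
  shows "(\<lambda>n. pmf (poisson_pmf m) n) sums 1"
    and "(\<lambda>n. real n * pmf (poisson_pmf m) n) sums m"
    and "(\<lambda>n. (real n)\<^sup>2 * pmf (poisson_pmf m) n) sums (m\<^sup>2 + m)"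
proof -
  have "(\<lambda>n. exp (-m) * (m ^ n /\<^sub>R fact n)) sums (exp (-m) * exp m)"
    by (intro sums_mult exp_converges)
  then show s0: "(\<lambda>n. pmf (poisson_pmf m) n) sums 1"
    using assms by (simp add: exp_minus_inverse mult.commute divide_inverse
        flip: exp_add)
  have Suc: "real (Suc n) * pmf (poisson_pmf m) (Suc n) = m * pmf (poisson_pmf m) n" for n
  proof -
    have "pmf (poisson_pmf m) (Suc n) = m ^ Suc n / (real (Suc n) * fact n) * exp (-m)"
      using assms by (simp only: pmf_poisson fact_Suc)
    then show ?thesis using assms by (simp del: of_nat_Suc)
  qed
  have "(\<lambda>n. real (Suc n) * pmf (poisson_pmf m) (Suc n)) sums (m * 1)"
    unfolding Suc by (intro sums_mult s0)
  from sums_Suc[OF this] show s1: "(\<lambda>n. real n * pmf (poisson_pmf m) n) sums m"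
    by simp
  have Suc2: "(real (Suc n))\<^sup>2 * pmf (poisson_pmf m) (Suc n)
      = m * (real n * pmf (poisson_pmf m) n + pmf (poisson_pmf m) n)" for n
  proof -
    have "(real (Suc n))\<^sup>2 * pmf (poisson_pmf m) (Suc n)
        = real (Suc n) * (real (Suc n) * pmf (poisson_pmf m) (Suc n))"
      by (simp only: power2_eq_square mult.assoc)
    also have "\<dots> = real (Suc n) * (m * pmf (poisson_pmf m) n)" by (simp only: Suc)
    finally show ?thesis by (simp add: algebra_simps del: pmf_poisson)
  qed
  have "(\<lambda>n. (real (Suc n))\<^sup>2 * pmf (poisson_pmf m) (Suc n)) sums (m * (m + 1))"
    unfolding Suc2 by (intro sums_mult sums_add s0 s1)
  from sums_Suc[OF this] show "(\<lambda>n. (real n)\<^sup>2 * pmf (poisson_pmf m) n) sums (m\<^sup>2 + m)"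
    by (simp add: power2_eq_square algebra_simps del: pmf_poisson)
qed

text \<open>
  Exponential tilting of a Poisson law is again Poisson. The factor in front is the Laplace
  transform at \<open>w\<close>.
\<close>
lemma poisson_pmf_tilt:
  assumes "l > 0"
  shows "pmf (poisson_pmf l) n * exp (- w * real n)
       = exp (l * (exp (-w) - 1)) * pmf (poisson_pmf (l * exp (-w))) n"
proof -
  have "exp (- w * real n) = exp (-w) ^ n"
    by (simp add: exp_of_nat_mult[symmetric] mult.commute)
  then show ?thesis
    using assms by (simp add: power_mult_distrib exp_diff exp_minus field_simps flip: exp_add)
qed

text \<open>The convolution of two Poisson laws is the binomial theorem.\<close>
lemma poisson_pmf_add:
  assumes "l > 0" "m > 0"
  shows "bind_pmf (poisson_pmf l) (\<lambda>x. map_pmf ((+) x) (poisson_pmf m)) = poisson_pmf (l + m)"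
proof (rule pmf_eqI)
  fix n :: nat
  have shift: "pmf (map_pmf ((+) x) (poisson_pmf m)) n
      = (if x \<le> n then pmf (poisson_pmf m) (n - x) else 0)" for x
  proof (cases "x \<le> n")
    case True
    have "pmf (map_pmf ((+) x) (poisson_pmf m)) (x + (n - x)) = pmf (poisson_pmf m) (n - x)"
      by (rule pmf_map_inj') (simp add: inj_on_def)
    then show ?thesis using True by simp
  next
    case False
    then have "n \<notin> (+) x ` set_pmf (poisson_pmf m)" by auto
    then show ?thesis using False by (subst pmf_map_outside) auto
  qed
  have "pmf (bind_pmf (poisson_pmf l) (\<lambda>x. map_pmf ((+) x) (poisson_pmf m))) n
      = (\<Sum>x\<le>n. pmf (poisson_pmf l) x *\<^sub>R (if x \<le> n then pmf (poisson_pmf m) (n - x) else 0))"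
    unfolding pmf_bind shift by (rule integral_measure_pmf) (auto split: if_splits)
  also have "\<dots> = (\<Sum>x\<le>n. real (n choose x) * l ^ x * m ^ (n - x) * (exp (- (l + m)) / fact n))"
    by (rule sum.cong)
      (use assms in \<open>auto simp: binomial_fact exp_diff exp_minus field_simps simp flip: exp_add\<close>)
  also have "\<dots> = pmf (poisson_pmf (l + m)) n"
    unfolding sum_distrib_right[symmetric] binomial_ring[symmetric] using assms by simp
  finally show "pmf (bind_pmf (poisson_pmf l) (\<lambda>x. map_pmf ((+) x) (poisson_pmf m))) n
      = pmf (poisson_pmf (l + m)) n" .
qed

abbreviation indep_poisson :: "nat set \<Rightarrow> (nat \<Rightarrow> real) \<Rightarrow> (nat \<Rightarrow> nat) measure" where
  "indep_poisson J l \<equiv> PiM J (\<lambda>k. measure_pmf (poisson_pmf (l k)))"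

text \<open>
  Adding the coordinates one at a time: Fubini splits off one Poisson variable, the induction
  hypothesis replaces the sum of the others by a single Poisson variable, and
  \<open>poisson_pmf_add\<close> merges the two. Arbitrary \<open>F\<close> keeps the induction hypothesis applicable
  to the inner integral. The index set is nonempty because \<open>poisson_pmf\<close> has an unspecified
  value at rate \<open>0\<close>.
\<close>
lemma nn_integral_sum_PiM_poisson:
  fixes l :: "nat \<Rightarrow> real" and F :: "nat \<Rightarrow> ennreal"
  assumes "finite J" "J \<noteq> {}" "\<And>i. i \<in> J \<Longrightarrow> l i > 0"
  shows "(\<integral>\<^sup>+\<omega>. F (\<Sum>i\<in>J. \<omega> i) \<partial>indep_poisson J l)
       = (\<integral>\<^sup>+s. F s \<partial>poisson_pmf (\<Sum>i\<in>J. l i))"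
  using assms
proof (induction J arbitrary: F rule: finite_ne_induct)
  case (singleton i)
  interpret product_sigma_finite "\<lambda>i. measure_pmf (poisson_pmf (l i))"
    by standard
  show ?case
    by simp (subst product_nn_integral_singleton, auto)
next
  case (insert i J)
  interpret product_sigma_finite "\<lambda>i. measure_pmf (poisson_pmf (l i))"
    by standard
  let ?P = "\<lambda>J. indep_poisson J l"
  have coord[measurable]: "(\<lambda>\<omega>. \<omega> j) \<in> measurable (?P K) (count_space UNIV)" if "j \<in> K" for j K
    using measurable_component_singleton[OF that, of "\<lambda>i. measure_pmf (poisson_pmf (l i))"]
    by (simp cong: measurable_cong_sets)
  have meas: "(\<lambda>\<omega>. F (\<Sum>j\<in>insert i J. \<omega> j)) \<in> borel_measurable (?P (insert i J))"
    by measurable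
  have pos: "l i > 0" "sum l J > 0"
    using insert by (auto intro!: sum_pos)
  have "(\<integral>\<^sup>+\<omega>. F (\<Sum>j\<in>insert i J. \<omega> j) \<partial>?P (insert i J))
      = (\<integral>\<^sup>+\<omega>. \<integral>\<^sup>+y. F (\<Sum>j\<in>insert i J. (fun_upd \<omega> i y) j) \<partial>poisson_pmf (l i) \<partial>?P J)"
    by (rule product_nn_integral_insert) (use insert meas in auto)
  also have "\<dots> = (\<integral>\<^sup>+\<omega>. \<integral>\<^sup>+y. F ((\<Sum>j\<in>J. \<omega> j) + y) \<partial>poisson_pmf (l i) \<partial>?P J)"
  proof -
    have "(\<Sum>j\<in>insert i J. (fun_upd \<omega> i y) j) = (\<Sum>j\<in>J. \<omega> j) + y"
      for \<omega> :: "nat \<Rightarrow> nat" and y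
    proof -
      have "(\<Sum>j\<in>J. (fun_upd \<omega> i y) j) = (\<Sum>j\<in>J. \<omega> j)"
        using insert by (intro sum.cong) auto
      then show ?thesis using insert by (simp del: fun_upd_apply, simp add: add.commute)
    qed
    then show ?thesis by (simp del: fun_upd_apply)
  qed
  also have "\<dots> = (\<integral>\<^sup>+x. \<integral>\<^sup>+y. F (x + y) \<partial>poisson_pmf (l i) \<partial>poisson_pmf (sum l J))"
    by (rule insert.IH) (use insert in auto)
  also have "\<dots> = (\<integral>\<^sup>+s. F s \<partial>poisson_pmf (sum l J + l i))"
    by (subst poisson_pmf_add[symmetric])
      (use pos in \<open>simp_all add: nn_integral_bind_pmf nn_integral_map_pmf\<close>)
  finally show ?case using insert by (simp add: add.commute)
qed

section \<open>The total of countably many independent Poisson counts\<close>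

text \<open>
  The total is read off from the real series, since that is what the Hamiltonian contains; on
  summable counts the floor only turns it back into a natural number.
\<close>
definition total_count :: "(nat \<Rightarrow> nat) \<Rightarrow> nat" where
  "total_count n = nat \<lfloor>\<Sum>k. real (n (Suc k))\<rfloor>"

text \<open>Summable natural numbers are eventually zero, so the partial sums become constant.\<close>
lemma summable_nat_eventually_total_count:
  fixes n :: "nat \<Rightarrow> nat"
  assumes "summable (\<lambda>k. real (n (Suc k)))"
  shows "\<forall>\<^sub>F m in sequentially. (\<Sum>k\<in>{1..m}. n k) = total_count n"
    and "(\<Sum>k. real (n (Suc k))) = real (total_count n)"
proof -
  have "(\<lambda>k. real (n (Suc k))) \<longlonglongrightarrow> 0" by (rule summable_LIMSEQ_zero[OF assms])
  then have "\<forall>\<^sub>F k in sequentially. real (n (Suc k)) < 1" by (rule order_tendstoD) simp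
  then obtain K where K: "n (Suc k) = 0" if "k \<ge> K" for k
    unfolding eventually_sequentially by auto
  have part: "(\<Sum>k. real (n (Suc k))) = real (\<Sum>k\<in>{1..m}. n k)" if "m \<ge> K" for m
  proof -
    have "(\<Sum>k. real (n (Suc k))) = (\<Sum>k<m. real (n (Suc k)))"
      by (rule suminf_finite) (use K that in auto)
    also have "\<dots> = (\<Sum>k\<in>{1..m}. real (n k))"
      by (rule sum.reindex_bij_witness[of _ "\<lambda>k. k - 1" Suc]) auto
    finally show ?thesis by simp
  qed
  have tot: "total_count n = (\<Sum>k\<in>{1..m}. n k)" if "m \<ge> K" for m
    unfolding total_count_def part[OF that] floor_of_nat nat_int ..
  show "\<forall>\<^sub>F m in sequentially. (\<Sum>k\<in>{1..m}. n k) = total_count n"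
    using tot unfolding eventually_sequentially by metis
  show "(\<Sum>k. real (n (Suc k))) = real (total_count n)"
    using tot[of K] part[of K] by simp
qed

lemma prob_space_indep_poisson: "prob_space (indep_poisson {1..} l)"
  by (intro prob_space_PiM prob_space_measure_pmf)

lemma measurable_count:
  assumes "k \<in> J"
  shows "(\<lambda>n. n k) \<in> measurable (indep_poisson J l) (count_space UNIV)"
  using measurable_component_singleton[OF assms, of "\<lambda>k. measure_pmf (poisson_pmf (l k))"]
  by (simp cong: measurable_cong_sets)

lemma measurable_count_Suc[measurable]:
  "(\<lambda>n. n (Suc k)) \<in> measurable (indep_poisson {1..} l) (count_space UNIV)"
  by (rule measurable_count) simp

lemma measurable_total_count[measurable]:
  "total_count \<in> measurable (indep_poisson {1..} l) (count_space UNIV)"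
proof -
  have "(\<lambda>n. \<lfloor>\<Sum>k. real (n (Suc k))\<rfloor>) \<in> measurable (indep_poisson {1..} l) (count_space UNIV)"
    by (rule measurable_compose[OF _ measurable_real_floor]) measurable
  then show ?thesis
    unfolding total_count_def[abs_def] by (rule measurable_compose) simp
qed

lemma measurable_partial_count:
  assumes "K \<subseteq> J"
  shows "(\<lambda>n. \<Sum>k\<in>K. n k) \<in> measurable (indep_poisson J l) (count_space UNIV)"
proof -
  have [measurable]: "(\<lambda>n. n k) \<in> measurable (indep_poisson J l) (count_space UNIV)"
    if "k \<in> K" for k
    using that assms by (intro measurable_count) auto
  show ?thesis by measurable
qed

context
  fixes l :: "nat \<Rightarrow> real"
  assumes l_pos: "\<And>k. k \<ge> 1 \<Longrightarrow> l k > 0"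
    and l_summable: "summable (\<lambda>k. l (Suc k))"
begin

lemma nn_integral_count:
  assumes "k \<ge> 1"
  shows "(\<integral>\<^sup>+n. ennreal (real (n k)) \<partial>indep_poisson {1..} l) = ennreal (l k)"
proof -
  have "distr (indep_poisson {1..} l) (poisson_pmf (l k)) (\<lambda>n. n k) = measure_pmf (poisson_pmf (l k))"
    using assms by (intro distr_PiM_component prob_space_measure_pmf) auto
  then have "(\<integral>\<^sup>+j. ennreal (real j) \<partial>poisson_pmf (l k))
      = (\<integral>\<^sup>+j. ennreal (real j) \<partial>distr (indep_poisson {1..} l) (poisson_pmf (l k)) (\<lambda>n. n k))" by simp
  also have "\<dots> = (\<integral>\<^sup>+n. ennreal (real (n k)) \<partial>indep_poisson {1..} l)"
    using assms by (intro nn_integral_distr measurable_component_singleton) auto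
  finally have "(\<integral>\<^sup>+n. ennreal (real (n k)) \<partial>indep_poisson {1..} l) = (\<integral>\<^sup>+j. ennreal (real j) \<partial>poisson_pmf (l k))" ..
  also have "\<dots> = (\<Sum>j. ennreal (pmf (poisson_pmf (l k)) j) * ennreal (real j))"
    by (simp add: nn_integral_measure_pmf nn_integral_count_space_nat)
  also have "\<dots> = (\<Sum>j. ennreal (real j * pmf (poisson_pmf (l k)) j))"
    by (simp only: ennreal_mult''[symmetric] pmf_nonneg of_nat_0_le_iff mult.commute)
  also have "\<dots> = ennreal (l k)"
    by (intro suminf_ennreal_eq poisson_pmf_sums(2) mult_nonneg_nonneg pmf_nonneg l_pos assms) simp
  finally show ?thesis .
qed

text \<open>The expected total is the sum of the rates, which is finite.\<close>
lemma AE_summable_count: "AE n in indep_poisson {1..} l. summable (\<lambda>k. real (n (Suc k)))"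
proof -
  have "(\<integral>\<^sup>+n. (\<Sum>k. ennreal (real (n (Suc k)))) \<partial>indep_poisson {1..} l) = (\<Sum>k. ennreal (l (Suc k)))"
    by (subst nn_integral_suminf) (auto simp: nn_integral_count simp del: One_nat_def)
  also have "\<dots> = ennreal (\<Sum>k. l (Suc k))"
    using l_pos l_summable by (intro suminf_ennreal2) (auto simp: less_imp_le)
  finally have "AE n in indep_poisson {1..} l. (\<Sum>k. ennreal (real (n (Suc k)))) \<noteq> \<infinity>"
    by (intro nn_integral_PInf_AE borel_measurable_suminf_order
        measurable_compose[OF measurable_count_Suc]) (simp_all del: One_nat_def)
  then show ?thesis
    by eventually_elim (auto intro!: summable_suminf_not_top)
qed

lemma emeasure_partial_count:
  assumes "m \<ge> 1"
  shows "emeasure (indep_poisson {1..} l)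
          {n \<in> space (indep_poisson {1..} l). (\<Sum>k\<in>{1..m}. n k) = j}
       = ennreal (pmf (poisson_pmf (\<Sum>k\<in>{1..m}. l k)) j)"
proof -
  interpret product_prob_space "\<lambda>k. measure_pmf (poisson_pmf (l k))" "{1..}"
    by (simp add: product_prob_space_def product_prob_space_axioms_def
        product_sigma_finite_def prob_space_imp_sigma_finite prob_space_measure_pmf)
  let ?J = "{1..m}"
  let ?P = "indep_poisson {1..} l"
  let ?F = "\<lambda>s. indicator {j} s :: ennreal"
  let ?R = "indep_poisson ?J l"
  have R: "distr ?P ?R (\<lambda>n. restrict n ?J) = ?R"
    by (rule distr_PiM_restrict_finite) auto
  have [measurable]: "(\<lambda>n. \<Sum>k\<in>?J. n k) \<in> measurable ?P (count_space UNIV)"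
    by (rule measurable_partial_count) auto
  have "emeasure ?P {n \<in> space ?P. (\<Sum>k\<in>?J. n k) = j}
      = (\<integral>\<^sup>+n. indicator {n \<in> space ?P. (\<Sum>k\<in>?J. n k) = j} n \<partial>?P)"
    by (rule nn_integral_indicator[symmetric]) measurable
  also have "\<dots> = (\<integral>\<^sup>+n. ?F (\<Sum>k\<in>?J. restrict n ?J k) \<partial>?P)"
    by (intro nn_integral_cong) (auto simp: indicator_def)
  also have "\<dots> = (\<integral>\<^sup>+n. ?F (\<Sum>k\<in>?J. n k) \<partial>distr ?P ?R (\<lambda>n. restrict n ?J))"
  proof (rule nn_integral_distr[symmetric])
    show "(\<lambda>n. restrict n ?J) \<in> measurable ?P ?R"
      by (rule measurable_restrict_subset) auto
    show "(\<lambda>n. ?F (\<Sum>k\<in>?J. n k)) \<in> borel_measurable (distr ?P ?R (\<lambda>n. restrict n ?J))"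
      unfolding R by (rule measurable_compose[OF measurable_partial_count[OF order_refl]]) simp
  qed
  also have "\<dots> = (\<integral>\<^sup>+s. ?F s \<partial>poisson_pmf (\<Sum>k\<in>?J. l k))"
    unfolding R by (rule nn_integral_sum_PiM_poisson) (use assms l_pos in auto)
  also have "\<dots> = ennreal (pmf (poisson_pmf (\<Sum>k\<in>?J. l k)) j)"
    by (simp add: emeasure_pmf_single)
  finally show ?thesis .
qed

text \<open>
  Almost surely the partial sums are eventually equal to the total, so the probability that a
  partial sum equals \<open>j\<close> tends to the probability that the total does. The former are Poisson
  probabilities, and these depend continuously on the rate.
\<close>
lemma distr_total_count:
  "distr (indep_poisson {1..} l) (count_space UNIV) total_count
   = measure_pmf (poisson_pmf (\<Sum>k. l (Suc k)))"
proof (rule measure_eqI_countable[of _ UNIV])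
  fix j :: nat
  interpret prob_space "indep_poisson {1..} l" by (rule prob_space_indep_poisson)
  let ?P = "indep_poisson {1..} l"
  let ?S = "\<lambda>m n. \<Sum>k\<in>{1..m}. n k :: nat"
  let ?L = "\<lambda>m. \<Sum>k\<in>{1..m}. l k"
  have [measurable]: "?S m \<in> measurable ?P (count_space UNIV)" for m
    by (rule measurable_partial_count; simp)+
  have ind: "(\<lambda>n. indicat_real {j} (X n)) \<in> borel_measurable ?P"
    if "X \<in> measurable ?P (count_space UNIV)" for X
    by (rule measurable_compose[OF that]) simp
  have ind_lim: "(\<lambda>m. \<integral>n. indicator {j} (?S m n) \<partial>?P)
      \<longlonglongrightarrow> (\<integral>n. indicat_real {j} (total_count n) \<partial>?P)"
  proof (rule integral_dominated_convergence[where w = "\<lambda>_. 1"])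
    show "(\<lambda>n. indicat_real {j} (total_count n)) \<in> borel_measurable ?P"
      "\<And>m. (\<lambda>n. indicat_real {j} (?S m n)) \<in> borel_measurable ?P"
      by (intro ind measurable_total_count measurable_partial_count; auto)+
    show "AE n in ?P. (\<lambda>m. indicat_real {j} (?S m n)) \<longlonglongrightarrow> indicator {j} (total_count n)"
      using AE_summable_count
    proof eventually_elim
      case (elim n)
      show ?case
        by (rule tendsto_eventually)
          (use summable_nat_eventually_total_count(1)[OF elim] in \<open>auto elim!: eventually_mono\<close>)
    qed
  qed (simp_all add: indicator_def del: One_nat_def)
  have ind_prob: "(\<integral>n. indicat_real {j} (X n) \<partial>?P)
      = measure ?P {n \<in> space ?P. X n = j}"
    if [measurable]: "X \<in> measurable ?P (count_space UNIV)" for X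
  proof -
    have "(\<integral>n. indicat_real {j} (X n) \<partial>?P)
        = (\<integral>n. indicator {n \<in> space ?P. X n = j} n \<partial>?P)"
      by (intro Bochner_Integration.integral_cong) (auto simp: indicator_def)
    also have "\<dots> = measure ?P ({n \<in> space ?P. X n = j} \<inter> space ?P)"
      by simp
    also have "{n \<in> space ?P. X n = j} \<inter> space ?P = {n \<in> space ?P. X n = j}" by blast
    finally show ?thesis .
  qed
  have lim: "(\<lambda>m. measure ?P {n \<in> space ?P. ?S m n = j})
      \<longlonglongrightarrow> measure ?P {n \<in> space ?P. total_count n = j}"
    using ind_lim
    unfolding ind_prob[OF measurable_total_count] ind_prob[OF \<open>?S _ \<in> _\<close>] .
  have shift: "?L m = (\<Sum>k<m. l (Suc k))" for m
    by (rule sum.reindex_bij_witness[of _ Suc "\<lambda>k. k - 1"]) auto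
  have Lpos: "0 < ?L m" if "m \<ge> 1" for m
    using that l_pos by (intro sum_pos) auto
  have Spos: "0 < (\<Sum>k. l (Suc k))"
    using l_pos l_summable by (intro suminf_pos) auto
  have "?L \<longlonglongrightarrow> (\<Sum>k. l (Suc k))"
    unfolding shift by (rule summable_LIMSEQ[OF l_summable])
  then have "(\<lambda>m. ?L m ^ j / fact j * exp (- ?L m))
      \<longlonglongrightarrow> (\<Sum>k. l (Suc k)) ^ j / fact j * exp (- (\<Sum>k. l (Suc k)))"
    by (intro tendsto_intros) auto
  moreover have "\<forall>\<^sub>F m in sequentially. ?L m ^ j / fact j * exp (- ?L m)
      = measure ?P {n \<in> space ?P. ?S m n = j}"
    using eventually_ge_at_top[of 1]
  proof eventually_elim
    case (elim m)
    then show ?case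
      using emeasure_partial_count[OF elim, of j]
      unfolding emeasure_eq_measure pmf_poisson[OF Lpos[OF elim]]
      using Lpos[OF elim] by (subst (asm) ennreal_inj) auto
  qed
  ultimately have "(\<lambda>m. measure ?P {n \<in> space ?P. ?S m n = j})
      \<longlonglongrightarrow> pmf (poisson_pmf (\<Sum>k. l (Suc k))) j"
    using Spos by (simp add: tendsto_cong)
  then have "measure ?P {n \<in> space ?P. total_count n = j} = pmf (poisson_pmf (\<Sum>k. l (Suc k))) j"
    by (rule LIMSEQ_unique[OF lim])
  then show "emeasure (distr ?P (count_space UNIV) total_count) {j}
      = emeasure (measure_pmf (poisson_pmf (\<Sum>k. l (Suc k)))) {j}"
    by (subst emeasure_distr[OF measurable_total_count])
      (auto simp: emeasure_eq_measure emeasure_pmf_single vimage_def Int_def conj_commute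
        simp del: One_nat_def)
qed auto

end

section \<open>Gaussian functionals of a Poisson variable\<close>

lemma poisson_expectation_sums:
  fixes g :: "nat \<Rightarrow> real"
  assumes "l > 0" "\<And>n. 0 \<le> g n" "\<And>n. g n \<le> 1"
  shows "(\<lambda>n. pmf (poisson_pmf l) n * g n) sums (LINT s|poisson_pmf l. g s)"
proof -
  have "integrable (measure_pmf (poisson_pmf l)) g"
    by (rule measure_pmf.integrable_const_bound[where B = 1]) (use assms in auto)
  then have "integrable (count_space UNIV) (\<lambda>n. pmf (poisson_pmf l) n *\<^sub>R g n)"
    unfolding measure_pmf_eq_density
    by (subst (asm) integrable_density) auto
  then have "(\<lambda>n. pmf (poisson_pmf l) n *\<^sub>R g n)
      sums (\<integral>n. pmf (poisson_pmf l) n *\<^sub>R g n \<partial>count_space UNIV)"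
    by (rule sums_integral_count_space_nat)
  also have "(\<integral>n. pmf (poisson_pmf l) n *\<^sub>R g n \<partial>count_space UNIV) = (LINT s|poisson_pmf l. g s)"
    unfolding measure_pmf_eq_density by (subst integral_density) auto
  finally show ?thesis by simp
qed

text \<open>
  A concave parabola lies below its tangent at \<open>s = V * t\<close>. Replacing the exponent by this
  tangent leaves a Laplace transform of the Poisson law.
\<close>
lemma poisson_gaussian_upper:
  fixes c t V l :: real
  assumes "l > 0" "V > 0" "c \<ge> 0"
  shows "(LINT s|poisson_pmf l. exp (- c * (real s)\<^sup>2 / (2 * V)))
       \<le> exp (V * c * t\<^sup>2 / 2 + l * (exp (- (c * t)) - 1))"
proof (rule sums_le)
  let ?g = "\<lambda>s. exp (- c * (real s)\<^sup>2 / (2 * V))"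
  let ?m = "l * exp (- (c * t))"
  show "(\<lambda>s. pmf (poisson_pmf l) s * ?g s) sums (LINT s|poisson_pmf l. ?g s)"
    using assms by (intro poisson_expectation_sums) auto
  show "(\<lambda>s. exp (V * c * t\<^sup>2 / 2 + l * (exp (- (c * t)) - 1)) * pmf (poisson_pmf ?m) s)
      sums exp (V * c * t\<^sup>2 / 2 + l * (exp (- (c * t)) - 1))"
    using sums_mult[OF poisson_pmf_sums(1)[of ?m]] assms by (metis exp_gt_zero mult.right_neutral mult_pos_pos)
  fix s :: nat
  have "- c * (real s)\<^sup>2 / (2 * V) = V * c * t\<^sup>2 / 2 - c * t * real s - c * (real s - V * t)\<^sup>2 / (2 * V)"
    using assms by (simp add: power2_eq_square field_simps)
  also have "\<dots> \<le> V * c * t\<^sup>2 / 2 - c * t * real s"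
    using assms by simp
  finally have "?g s \<le> exp (V * c * t\<^sup>2 / 2) * exp (- (c * t) * real s)"
    by (simp flip: exp_add)
  then have "pmf (poisson_pmf l) s * ?g s
      \<le> pmf (poisson_pmf l) s * (exp (V * c * t\<^sup>2 / 2) * exp (- (c * t) * real s))"
    by (intro mult_left_mono pmf_nonneg)
  also have "\<dots> = exp (V * c * t\<^sup>2 / 2) * (pmf (poisson_pmf l) s * exp (- (c * t) * real s))"
    by (simp only: ac_simps)
  finally show "pmf (poisson_pmf l) s * ?g s
      \<le> exp (V * c * t\<^sup>2 / 2 + l * (exp (- (c * t)) - 1)) * pmf (poisson_pmf ?m) s"
    unfolding poisson_pmf_tilt[OF assms(1)] exp_add by (simp only: mult.assoc)
qed

text \<open>
  Under the tilted law with mean \<open>m\<close> the expectation is that of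
  \<open>exp (c * t * s - c * s\<^sup>2 / (2 * V))\<close>, up to the Laplace transform. Jensen's inequality, in the
  form \<open>exp z \<ge> exp y * (1 + (z - y))\<close> with \<open>y\<close> the mean of the exponent \<open>z\<close>, bounds this from
  below by \<open>exp y\<close>. The exponent is quadratic in \<open>s\<close>, so \<open>y\<close> comes from two moments of the
  tilted law.
\<close>
lemma poisson_gaussian_lower:
  fixes c t V l m :: real
  assumes "l > 0" "V > 0" "c \<ge> 0"
  defines "m \<equiv> l * exp (- (c * t))"
  shows "exp (l * (exp (- (c * t)) - 1) + (c * t * m - c / (2 * V) * (m\<^sup>2 + m)))
       \<le> (LINT s|poisson_pmf l. exp (- c * (real s)\<^sup>2 / (2 * V)))"
proof (rule sums_le)
  let ?g = "\<lambda>s. exp (- c * (real s)\<^sup>2 / (2 * V))"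
  define y where "y = c * t * m - c / (2 * V) * (m\<^sup>2 + m)"
  define C where "C = exp (l * (exp (- (c * t)) - 1)) * exp y"
  let ?p = "pmf (poisson_pmf m)"
  have m: "m > 0" using assms by simp
  show "(\<lambda>s. pmf (poisson_pmf l) s * ?g s) sums (LINT s|poisson_pmf l. ?g s)"
    using assms by (intro poisson_expectation_sums) auto
  have "(\<lambda>s. C * ((1 - y) * ?p s + c * t * (real s * ?p s) - c / (2 * V) * ((real s)\<^sup>2 * ?p s)))
      sums (C * ((1 - y) * 1 + c * t * m - c / (2 * V) * (m\<^sup>2 + m)))"
    by (intro sums_mult sums_add sums_diff poisson_pmf_sums m)
  then show "(\<lambda>s. C * ((1 - y) * ?p s + c * t * (real s * ?p s) - c / (2 * V) * ((real s)\<^sup>2 * ?p s)))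
      sums exp (l * (exp (- (c * t)) - 1) + (c * t * m - c / (2 * V) * (m\<^sup>2 + m)))"
    by (simp add: C_def exp_add y_def)
  fix s :: nat
  define z where "z = c * t * real s - c / (2 * V) * (real s)\<^sup>2"
  have "1 + (z - y) \<le> exp (z - y)" by (rule exp_ge_add_one_self)
  then have "exp y * (1 + (z - y)) \<le> exp y * exp (z - y)" by (intro mult_left_mono) auto
  then have z: "exp y * (1 + (z - y)) \<le> exp z" by (simp add: exp_diff)
  have "C * ((1 - y) * ?p s + c * t * (real s * ?p s) - c / (2 * V) * ((real s)\<^sup>2 * ?p s))
      = (exp (l * (exp (- (c * t)) - 1)) * ?p s) * (exp y * (1 + (z - y)))"
    by (simp add: C_def z_def algebra_simps del: pmf_poisson)
  also have "\<dots> \<le> (exp (l * (exp (- (c * t)) - 1)) * ?p s) * exp z"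
    by (intro mult_left_mono z mult_nonneg_nonneg pmf_nonneg) simp
  also have "\<dots> = pmf (poisson_pmf l) s * (exp (- (c * t) * real s) * exp z)"
    unfolding m_def poisson_pmf_tilt[OF assms(1), symmetric] by (simp only: mult.assoc)
  also have "exp (- (c * t) * real s) * exp z = ?g s"
    by (simp add: z_def flip: exp_add)
  finally show "C * ((1 - y) * ?p s + c * t * (real s * ?p s) - c / (2 * V) * ((real s)\<^sup>2 * ?p s))
      \<le> pmf (poisson_pmf l) s * ?g s" .
qed

section \<open>The pressure\<close>

text \<open>
  The Hamiltonian depends on the counts only through their total, so the partition function is an
  expectation over the law of the total.
\<close>
lemma Z_CMF_eq_poisson:
  assumes "d \<ge> 1" "\<beta> > 0" "\<alpha> \<le> 0" "N \<ge> 1"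
  shows "Z_CMF d \<beta> \<alpha> a N = (LINT s|poisson_pmf (vol d N * qbar d \<beta> \<alpha>).
           exp (- (a * \<beta>) * (real s)\<^sup>2 / (2 * vol d N)))"
proof -
  define V where "V = vol d N"
  define l where "l k = V * q d \<beta> \<alpha> k" for k
  have V: "V > 0" using assms by (simp add: V_def vol_def)
  have l_pos: "l k > 0" if "k \<ge> 1" for k
    unfolding l_def using V q_pos assms that by auto
  have l_summable: "summable (\<lambda>k. l (Suc k))"
    unfolding l_def by (intro summable_mult summable_q assms)
  have l_sum: "(\<Sum>k. l (Suc k)) = V * qbar d \<beta> \<alpha>"
    unfolding l_def qbar_def by (rule suminf_mult[OF summable_q]) (use assms in auto)
  let ?P = "indep_poisson {1..} l"
  let ?M = "restrict_space (PiM {1..} (\<lambda>_::nat. borel :: real measure)) ell1_nonneg"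
  let ?f = "\<lambda>n. if scaled_counts d N n \<in> ell1_nonneg then scaled_counts d N n else (\<lambda>k\<in>{1..}. 0)"
  let ?g = "\<lambda>x. exp (- \<beta> * vol d N * H_CMF a x)"
  let ?h = "\<lambda>s. exp (- (a * \<beta>) * (real s)\<^sup>2 / (2 * V))"
  have P: "poisson_family d \<beta> \<alpha> N = ?P"
    unfolding poisson_family_def l_def V_def ..
  note [measurable] = measurable_count_Suc measurable_total_count
  have in_ell1: "scaled_counts d N n \<in> ell1_nonneg \<longleftrightarrow> summable (\<lambda>k. real (n (Suc k)))" for n
    using V by (auto simp: ell1_nonneg_def ell1_def scaled_counts_def V_def[symmetric])
  have scaled: "scaled_counts d N \<in> measurable ?P (PiM {1..} (\<lambda>_. borel))"
    unfolding scaled_counts_def[abs_def]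
  proof (rule measurable_restrict)
    fix k :: nat assume "k \<in> {1..}"
    then have "(\<lambda>n. n k) \<in> measurable ?P (count_space UNIV)"
      by (rule measurable_count)
    then show "(\<lambda>n. real (n k) / vol d N) \<in> borel_measurable ?P"
      by (rule measurable_compose) simp
  qed
  \<comment> \<open>In the extended nonnegative reals the series always converges, and comparing its
    measurable value with infinity decides summability.\<close>
  have pred: "Measurable.pred ?P (\<lambda>n. scaled_counts d N n \<in> ell1_nonneg)"
  proof -
    have "summable (\<lambda>k. real (n (Suc k))) \<longleftrightarrow> (\<Sum>k. ennreal (real (n (Suc k)))) \<noteq> \<top>" for n
      by (auto intro: summable_suminf_not_top simp: suminf_ennreal2)
    moreover have "(\<lambda>n. \<Sum>k. ennreal (real (n (Suc k)))) \<in> borel_measurable ?P"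
      by (intro borel_measurable_suminf_order measurable_compose[OF measurable_count_Suc]) simp
    ultimately show ?thesis unfolding in_ell1 by simp
  qed
  have zero: "(\<lambda>k\<in>{1..}. 0) \<in> ell1_nonneg"
    by (simp add: ell1_nonneg_def ell1_def)
  have f: "?f \<in> measurable ?P ?M"
  proof (rule measurable_restrict_space2)
    show "?f \<in> space ?P \<rightarrow> ell1_nonneg" using zero by auto
    show "?f \<in> measurable ?P (PiM {1..} (\<lambda>_. borel))"
      by (intro measurable_If scaled pred[unfolded pred_def]) (auto simp: space_PiM)
  qed
  have "(\<lambda>x. x (Suc k)) \<in> borel_measurable (PiM {1..} (\<lambda>_. borel :: real measure))" for k
    by (rule measurable_component_singleton) simp
  note [measurable] = this
  have g: "?g \<in> borel_measurable (PiM {1..} (\<lambda>_. borel))"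
    unfolding H_CMF_def by measurable
  have gf: "?g (?f n) = ?h (total_count n)" if "summable (\<lambda>k. real (n (Suc k)))" for n
  proof -
    have "(\<Sum>k. scaled_counts d N n (Suc k)) = real (total_count n) / V"
      using suminf_divide[OF that, of V] summable_nat_eventually_total_count(2)[OF that]
      by (simp add: scaled_counts_def V_def)
    then show ?thesis
      using that V by (simp add: in_ell1 H_CMF_def V_def[symmetric] power2_eq_square)
  qed
  have "Z_CMF d \<beta> \<alpha> a N = (LINT n|?P. ?g (?f n))"
    unfolding Z_CMF_def \<nu>_def P
    by (rule integral_distr) (use f g in \<open>auto intro: measurable_restrict_space1\<close>)
  also have "\<dots> = (LINT n|?P. ?h (total_count n))"
  proof (rule integral_cong_AE)
    show "(\<lambda>n. ?g (?f n)) \<in> borel_measurable ?P"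
      by (rule measurable_compose[OF f]) (use g in \<open>auto intro: measurable_restrict_space1\<close>)
    show "(\<lambda>n. ?h (total_count n)) \<in> borel_measurable ?P"
      by (rule measurable_compose[OF measurable_total_count]) simp
    show "AE n in ?P. ?g (?f n) = ?h (total_count n)"
    proof -
      have "AE n in ?P. summable (\<lambda>k. real (n (Suc k)))"
        by (rule AE_summable_count) (use l_pos l_summable in auto)
      then show ?thesis by eventually_elim (rule gf)
    qed
  qed
  also have "\<dots> = (LINT s|distr ?P (count_space UNIV) total_count. ?h s)"
    by (rule integral_distr[symmetric, OF measurable_total_count]) simp
  also have "\<dots> = (LINT s|poisson_pmf (V * qbar d \<beta> \<alpha>). ?h s)"
    by (subst distr_total_count) (use l_pos l_summable l_sum in auto)
  finally show ?thesis unfolding V_def .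
qed

lemma qbar_pos:
  assumes "d \<ge> 1" "\<beta> > 0" "\<alpha> \<le> 0" shows "qbar d \<beta> \<alpha> > 0"
  unfolding qbar_def using summable_q assms q_pos by (intro suminf_pos) auto

text \<open>
  With the density \<open>t\<close> solving the fixed point equation, tilting a Poisson law of mean
  \<open>V * qbar\<close> by \<open>exp (- a * \<beta> * t * s)\<close> moves its mean to \<open>V * t\<close>, which is exactly the point of
  tangency in the upper bound. The two bounds then differ only by the factor
  \<open>exp (- a * \<beta> * t / 2)\<close>, which comes from the variance \<open>V * t\<close> and does not depend on \<open>V\<close>.
\<close>
lemma p_CMF_N_tendsto:
  assumes "d \<ge> 1" "\<beta> > 0" "\<alpha> \<le> 0" "a \<ge> 0"
    and t: "t = qbar d \<beta> \<alpha> * exp (- (a * \<beta> * t))"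
  shows "p_CMF_N d \<beta> \<alpha> a \<longlonglongrightarrow> (a * \<beta> * t\<^sup>2 / 2 + t - qbar d \<beta> \<alpha>) / \<beta>"
proof -
  define c where "c = a * \<beta>"
  define Q where "Q = qbar d \<beta> \<alpha>"
  define p where "p = c * t\<^sup>2 / 2 + t - Q"
  have c: "c \<ge> 0" and Q: "Q > 0" and t': "Q * exp (- (c * t)) = t"
    using assms qbar_pos t by (auto simp: c_def Q_def)
  have bounds: "(p - c * t / 2 * inverse (vol d N)) / \<beta> \<le> p_CMF_N d \<beta> \<alpha> a N
      \<and> p_CMF_N d \<beta> \<alpha> a N \<le> p / \<beta>" if N: "N \<ge> 1" for N
  proof -
    define V where "V = vol d N"
    have V: "V > 0" using N by (simp add: V_def vol_def)
    have VQt: "V * Q * exp (- (c * t)) = V * t" using t' by (simp add: mult.assoc)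
    define Z where "Z = Z_CMF d \<beta> \<alpha> a N"
    have Z: "Z = (LINT s|poisson_pmf (V * Q). exp (- c * (real s)\<^sup>2 / (2 * V)))"
      unfolding Z_def V_def Q_def c_def using assms N by (intro Z_CMF_eq_poisson)
    have "Z \<le> exp (V * c * t\<^sup>2 / 2 + V * Q * (exp (- (c * t)) - 1))"
      unfolding Z using V Q c by (intro poisson_gaussian_upper) auto
    also have "V * c * t\<^sup>2 / 2 + V * Q * (exp (- (c * t)) - 1) = V * p"
      using VQt by (simp add: p_def algebra_simps)
    finally have up: "Z \<le> exp (V * p)" .
    have "exp (V * Q * (exp (- (c * t)) - 1) + (c * t * (V * t) - c / (2 * V) * ((V * t)\<^sup>2 + V * t))) \<le> Z"
      unfolding Z VQt[symmetric] using V Q c by (intro poisson_gaussian_lower) auto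
    also have "V * Q * (exp (- (c * t)) - 1) + (c * t * (V * t) - c / (2 * V) * ((V * t)\<^sup>2 + V * t))
        = V * p - c * t / 2"
      using VQt V by (simp add: p_def power2_eq_square field_simps)
    finally have low: "exp (V * p - c * t / 2) \<le> Z" .
    have "Z > 0" using low by (rule less_le_trans[OF exp_gt_zero])
    then have "V * p - c * t / 2 \<le> ln Z" "ln Z \<le> V * p"
      using low up ln_ge_iff[of Z "V * p - c * t / 2"] ln_le_cancel_iff[of Z "exp (V * p)"]
      by simp_all
    moreover have "V * (p - c * t / 2 * inverse V) = V * p - c * t / 2"
      using V by (simp add: right_diff_distrib)
    ultimately have "V * (p - c * t / 2 * inverse V) \<le> ln Z" "ln Z \<le> V * p" by simp_all
    then have "(p - c * t / 2 * inverse V) \<le> ln Z / V" "ln Z / V \<le> p"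
      using V by (simp_all add: pos_le_divide_eq pos_divide_le_eq mult.commute)
    then have "(p - c * t / 2 * inverse V) / \<beta> \<le> ln Z / V / \<beta>" "ln Z / V / \<beta> \<le> p / \<beta>"
      using assms by (auto simp del: divide_divide_eq_left intro!: divide_right_mono)
    then show ?thesis
      by (simp add: p_CMF_N_def Z_def V_def mult.commute)
  qed
  have "filterlim (vol d) at_top sequentially"
    unfolding vol_def
    using assms by (intro filterlim_pow_at_top filterlim_tendsto_pos_mult_at_top[OF tendsto_const]
        filterlim_real_sequentially) auto
  then have "(\<lambda>N. (p - c * t / 2 * inverse (vol d N)) / \<beta>) \<longlonglongrightarrow> (p - c * t / 2 * 0) / \<beta>"
    using assms by (intro tendsto_intros tendsto_inverse_0_at_top) auto
  then have "(\<lambda>N. (p - c * t / 2 * inverse (vol d N)) / \<beta>) \<longlonglongrightarrow> p / \<beta>" by simp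
  then have "p_CMF_N d \<beta> \<alpha> a \<longlonglongrightarrow> p / \<beta>"
    by (rule tendsto_sandwich[rotated 2, OF _ tendsto_const])
      (use bounds in \<open>auto intro!: eventually_sequentiallyI[of 1]\<close>)
  then show ?thesis by (simp add: p_def c_def Q_def)
qed

section \<open>The rate function\<close>

text \<open>
  This is the relative entropy of the Poisson law of rate \<open>x\<close> with respect to the one of
  rate \<open>y\<close>.
\<close>
definition relent :: "real \<Rightarrow> real \<Rightarrow> real" where
  "relent x y = x * ln (x / y) - x + y"

lemma relent_nonneg:
  assumes "x \<ge> 0" "y > 0"
  shows "relent x y \<ge> 0" and "relent x y = 0 \<longleftrightarrow> x = y"
proof -
  have "relent x y \<ge> 0 \<and> (relent x y = 0 \<longleftrightarrow> x = y)"
  proof (cases "x = 0")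
    case True
    then show ?thesis using assms by (simp add: relent_def)
  next
    case False
    define u where "u = y / x"
    have u: "u > 0" and x: "x > 0" using False assms by (auto simp: u_def)
    \<comment> \<open>In this form the claim is the inequality \<open>ln u \<le> u - 1\<close> with its case of equality.\<close>
    have "relent x y = x * (u - 1 - ln u)"
      using x assms by (simp add: relent_def u_def ln_div field_simps)
    moreover have "ln u \<le> u - 1" by (rule ln_le_minus_one[OF u])
    moreover have "ln u = u - 1 \<longleftrightarrow> u = 1"
      using ln_eq_minus_one[OF u] by auto
    moreover have "u = 1 \<longleftrightarrow> x = y" using x by (auto simp: u_def)
    ultimately show ?thesis using x by auto
  qed
  then show "relent x y \<ge> 0" "relent x y = 0 \<longleftrightarrow> x = y" by auto
qed

lemma suminf_ereal_add_real:
  assumes "\<And>k. 0 \<le> (D k :: real)" "r sums s"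
  shows "(\<Sum>k. ereal (D k + r k)) = (\<Sum>k. ereal (D k)) + ereal s"
proof -
  have "(\<lambda>k. ereal (D k)) sums (\<Sum>k. ereal (D k))"
    using assms(1) by (intro summable_sums summable_ereal_pos) auto
  moreover have "(\<lambda>k. ereal (r k)) sums ereal s"
    using assms(2) by (simp add: sums_ereal)
  ultimately have "(\<lambda>k. ereal (D k) + ereal (r k)) sums ((\<Sum>k. ereal (D k)) + ereal s)"
    unfolding sums_def sum.distrib by (intro tendsto_add_ereal_general1) auto
  then show ?thesis by (simp add: sums_unique[symmetric])
qed

text \<open>
  Let \<open>s\<close> be the total mass of \<open>x\<close> and \<open>w = a * \<beta> * t\<close>. Passing from the reference sequence
  \<open>q\<close> to \<open>\<xi>\<close> turns the summand of index \<open>k\<close> in \<open>I\<close> into the difference of a relative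
  entropy divided by \<open>\<beta>\<close> and \<open>(w * x k + \<xi> k) / \<beta>\<close>. The sum of the correction is \<open>(w * s + t) / \<beta>\<close>, because \<open>\<xi>\<close> has total
  mass \<open>t\<close>, and \<open>w * s / \<beta> = a * t * s\<close> is the linear term that completes the square in the
  Hamiltonian.
\<close>
lemma energy_eq_square_plus_relent:
  assumes "d \<ge> 1" "\<beta> > 0" "\<alpha> \<le> 0"
    and t: "t = qbar d \<beta> \<alpha> * exp (- (a * \<beta> * t))"
    and x: "x \<in> ell1_nonneg"
  defines "\<xi> \<equiv> \<lambda>k. exp (- (a * \<beta> * t)) * q d \<beta> \<alpha> k"
  shows "ereal (H_CMF a x) + I d \<beta> \<alpha> x
       = (ereal (a / 2 * ((\<Sum>k. x (Suc k)) - t)\<^sup>2) + (\<Sum>k. ereal (relent (x (Suc k)) (\<xi> (Suc k)) / \<beta>)))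
         + ereal (- (a * \<beta> * t\<^sup>2 / 2 + t - qbar d \<beta> \<alpha>) / \<beta>)"
proof -
  define w where "w = a * \<beta> * t"
  define Q where "Q = qbar d \<beta> \<alpha>"
  define s where "s = (\<Sum>k. x (Suc k))"
  define S where "S = (\<Sum>k. ereal (relent (x (Suc k)) (\<xi> (Suc k)) / \<beta>))"
  let ?D = "\<lambda>k. relent (x (Suc k)) (\<xi> (Suc k)) / \<beta>"
  let ?r = "\<lambda>k. - (w * x (Suc k) + \<xi> (Suc k)) / \<beta>"
  have x0: "x (Suc k) \<ge> 0" for k using x by (simp add: ell1_nonneg_def)
  have xs: "(\<lambda>k. x (Suc k)) sums s"
    using x x0 unfolding s_def by (intro summable_sums) (simp add: ell1_nonneg_def ell1_def)
  have \<xi>0: "\<xi> (Suc k) > 0" for k using q_pos assms by (simp add: \<xi>_def)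
  have "(\<lambda>k. \<xi> (Suc k)) sums (exp (- (a * \<beta> * t)) * Q)"
    unfolding \<xi>_def Q_def qbar_def using summable_q assms by (intro sums_mult summable_sums) auto
  then have \<xi>s: "(\<lambda>k. \<xi> (Suc k)) sums t" using t by (simp add: Q_def mult.commute)
  have "x (Suc k) / \<beta> * (ln (x (Suc k) / q d \<beta> \<alpha> (Suc k)) - 1) = ?D k + ?r k" for k
  proof (cases "x (Suc k) = 0")
    case True
    then show ?thesis by (simp add: relent_def)
  next
    case False
    have q: "q d \<beta> \<alpha> (Suc k) > 0" using q_pos assms by simp
    have "ln (x (Suc k) / \<xi> (Suc k)) = ln (x (Suc k) / q d \<beta> \<alpha> (Suc k)) + w"
      using False x0[of k] q unfolding \<xi>_def w_def by (simp add: ln_div ln_mult)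
    then show ?thesis using assms by (simp add: relent_def field_simps)
  qed
  moreover have "?r sums (- (w * s + t) / \<beta>)"
    by (intro sums_divide sums_minus sums_add sums_mult xs \<xi>s)
  moreover have "0 \<le> ?D k" for k using relent_nonneg(1)[OF x0 \<xi>0] assms by simp
  ultimately have I: "I d \<beta> \<alpha> x = (S + ereal (- (w * s + t) / \<beta>)) + ereal (Q / \<beta>)"
    unfolding I_def S_def Q_def using x by (simp add: suminf_ereal_add_real)
  have H: "H_CMF a x = a / 2 * s\<^sup>2" by (simp add: H_CMF_def s_def)
  have "a / 2 * s\<^sup>2 + (- (w * s + t) / \<beta>) + Q / \<beta> = a / 2 * (s - t)\<^sup>2 + (- (a * \<beta> * t\<^sup>2 / 2 + t - Q) / \<beta>)"
    using assms by (simp add: w_def power2_eq_square field_simps)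
  then show ?thesis
    unfolding I H S_def[symmetric] s_def[symmetric] Q_def[symmetric]
    by (cases S) auto
qed

text \<open>
  The square and the entropies in the energy identity are nonnegative. At \<open>\<xi>\<close> they vanish,
  as \<open>\<xi>\<close> has total mass \<open>t\<close> by the fixed point equation, so the infimum is the constant. Conversely,
  vanishing entropies force equality of every coordinate.
\<close>
lemma I_CMF_zero_set:
  assumes "d \<ge> 1" "\<beta> > 0" "\<alpha> \<le> 0" "a \<ge> 0"
    and t: "t = qbar d \<beta> \<alpha> * exp (- (a * \<beta> * t))"
  defines "\<xi> \<equiv> \<lambda>k\<in>{1..}. exp (- (a * \<beta> * t)) * q d \<beta> \<alpha> k"
  shows "{x \<in> ell1. I_CMF d \<beta> \<alpha> a x = 0} = {\<xi>}"
proof -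
  define F where "F x = ereal (H_CMF a x) + I d \<beta> \<alpha> x" for x
  define R where "R x = ereal (a / 2 * ((\<Sum>k. x (Suc k)) - t)\<^sup>2)
      + (\<Sum>k. ereal (relent (x (Suc k)) (\<xi> (Suc k)) / \<beta>))" for x
  define m where "m = - (a * \<beta> * t\<^sup>2 / 2 + t - qbar d \<beta> \<alpha>) / \<beta>"
  have F: "F x = R x + ereal m" if "x \<in> ell1_nonneg" for x
    using energy_eq_square_plus_relent[OF assms(1-3) t that]
    by (simp add: F_def R_def m_def \<xi>_def)
  have F_top: "F x = \<infinity>" if "x \<notin> ell1_nonneg" for x
    using that by (simp add: F_def I_def)
  have \<xi>0: "\<xi> (Suc k) > 0" for k using q_pos assms by (simp add: \<xi>_def)
  have \<xi>s: "(\<lambda>k. \<xi> (Suc k)) sums t"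
    using sums_mult[OF summable_sums[OF summable_q[OF assms(1-3)]], of "exp (- (a * \<beta> * t))"] t
    by (simp add: \<xi>_def qbar_def mult.commute)
  have \<xi>_in: "\<xi> \<in> ell1_nonneg"
    using \<xi>s \<xi>0 q_pos assms by (auto simp: ell1_nonneg_def ell1_def sums_iff less_imp_le abs_of_pos)
  have D0: "0 \<le> ereal (relent (x (Suc k)) (\<xi> (Suc k)) / \<beta>)" if "x \<in> ell1_nonneg" for x k
    using relent_nonneg(1)[OF _ \<xi>0, of "x (Suc k)" k] that assms by (simp add: ell1_nonneg_def)
  have R0: "R x \<ge> 0" if "x \<in> ell1_nonneg" for x
    unfolding R_def using D0[OF that] assms by (intro add_nonneg_nonneg suminf_0_le) auto
  have R_\<xi>: "R \<xi> = 0"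
  proof -
    have "relent (\<xi> (Suc k)) (\<xi> (Suc k)) = 0" for k
      using \<xi>0[of k] by (simp add: relent_def)
    then show ?thesis unfolding R_def sums_unique[OF \<xi>s, symmetric] by (simp flip: zero_ereal_def)
  qed
  have R_eq: "x = \<xi>" if x: "x \<in> ell1_nonneg" and R: "R x = 0" for x
  proof
    fix k
    have sum0: "(\<Sum>k. ereal (relent (x (Suc k)) (\<xi> (Suc k)) / \<beta>)) = 0"
    proof (rule antisym)
      have "(\<Sum>k. ereal (relent (x (Suc k)) (\<xi> (Suc k)) / \<beta>)) \<le> R x"
        unfolding R_def using assms by (intro add_increasing) auto
      then show "(\<Sum>k. ereal (relent (x (Suc k)) (\<xi> (Suc k)) / \<beta>)) \<le> 0" using R by simp
    qed (intro suminf_0_le D0[OF x])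
    have "relent (x (Suc j)) (\<xi> (Suc j)) = 0" for j
    proof -
      have "ereal (relent (x (Suc j)) (\<xi> (Suc j)) / \<beta>)
          \<le> (\<Sum>k<Suc j. ereal (relent (x (Suc k)) (\<xi> (Suc k)) / \<beta>))"
        unfolding sum.lessThan_Suc by (intro add_increasing sum_nonneg D0[OF x] order_refl)
      also have "\<dots> \<le> (\<Sum>k. ereal (relent (x (Suc k)) (\<xi> (Suc k)) / \<beta>))"
        by (rule suminf_upper[OF D0[OF x]])
      finally have "relent (x (Suc j)) (\<xi> (Suc j)) / \<beta> \<le> 0"
        unfolding sum0 by simp
      then have "relent (x (Suc j)) (\<xi> (Suc j)) \<le> 0"
        using assms(2) by (simp add: divide_le_0_iff)
      moreover have "0 \<le> relent (x (Suc j)) (\<xi> (Suc j))"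
        using D0[OF x, of j] assms(2) by (simp add: zero_le_divide_iff)
      ultimately show ?thesis by (rule antisym)
    qed
    then have eq: "x (Suc j) = \<xi> (Suc j)" for j
      using relent_nonneg(2)[OF _ \<xi>0, of "x (Suc j)" j] x by (simp add: ell1_nonneg_def)
    show "x k = \<xi> k"
    proof (cases k)
      case 0
      then show ?thesis
        using x \<xi>_in by (simp add: ell1_nonneg_def ell1_def extensional_def)
    qed (simp add: eq)
  qed
  have inf: "(INF y\<in>ell1. F y) = ereal m"
  proof (rule antisym)
    have "\<xi> \<in> ell1" using \<xi>_in by (simp add: ell1_nonneg_def)
    then have "(INF y\<in>ell1. F y) \<le> F \<xi>" by (rule INF_lower)
    then show "(INF y\<in>ell1. F y) \<le> ereal m" using F[OF \<xi>_in] R_\<xi> by simp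
    show "ereal m \<le> (INF y\<in>ell1. F y)"
    proof (rule INF_greatest)
      fix y
      show "ereal m \<le> F y"
      proof (cases "y \<in> ell1_nonneg")
        case True
        then show ?thesis using F R0 add_increasing[of "R y" "ereal m" "ereal m"] by simp
      qed (simp add: F_top)
    qed
  qed
  have IC: "I_CMF d \<beta> \<alpha> a x = F x - ereal m" for x
    unfolding I_CMF_def using inf by (simp add: F_def)
  have zero_iff: "I_CMF d \<beta> \<alpha> a x = 0 \<longleftrightarrow> x \<in> ell1_nonneg \<and> R x = 0" for x
  proof (cases "x \<in> ell1_nonneg")
    case True
    then show ?thesis unfolding IC F[OF True] by (cases "R x") auto
  qed (simp add: IC F_top)
  show ?thesis
  proof (intro equalityI subsetI)
    fix x assume "x \<in> {x \<in> ell1. I_CMF d \<beta> \<alpha> a x = 0}"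
    then have "x = \<xi>" unfolding zero_iff by (blast intro: R_eq)
    then show "x \<in> {\<xi>}" by blast
  next
    fix x assume "x \<in> {\<xi>}"
    then have x: "x = \<xi>" by (rule singletonD)
    have "\<xi> \<in> ell1" using \<xi>_in unfolding ell1_nonneg_def by blast
    then show "x \<in> {x \<in> ell1. I_CMF d \<beta> \<alpha> a x = 0}"
      unfolding x zero_iff using \<xi>_in R_\<xi> by blast
  qed
qed

section \<open>The closed formulas\<close>

theorem proposition3p1:
  fixes d :: nat and \<beta> \<alpha> :: real
  assumes "d \<ge> 1" and "\<beta> > 0" and "\<alpha> \<le> 0"
  shows "(\<forall>a>0. {x \<in> ell1. I_CMF d \<beta> \<alpha> a x = 0} = {\<xi>_CMF d \<beta> \<alpha> a}) \<and>
         (\<forall>a\<ge>0. p_CMF_N d \<beta> \<alpha> a \<longlonglongrightarrow> p_CMF d \<beta> \<alpha> a) \<and>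
         (\<forall>a>0. qbar d \<beta> \<alpha> / \<beta> + p_CMF d \<beta> \<alpha> a = p_CMF_formula d \<beta> \<alpha> a) \<and>
         (p_CMF_formula d \<beta> \<alpha> \<longlongrightarrow> qbar d \<beta> \<alpha> / \<beta> + p_CMF d \<beta> \<alpha> 0) (at_right 0)"
proof -
  define Q where "Q = qbar d \<beta> \<alpha>"
  define w where "w a = W0 (a * \<beta> * Q)" for a
  define t where "t a = (if a = 0 then Q else w a / (a * \<beta>))" for a
  have Q: "Q > 0" unfolding Q_def by (rule qbar_pos[OF assms])
  have w: "w a > 0" "w a * exp (w a) = a * \<beta> * Q" if "a > 0" for a
    using W0_pos[of "a * \<beta> * Q"] that assms Q by (auto simp: w_def)
  have wt: "w a = a * \<beta> * t a" if "a > 0" for a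
    using that assms by (simp add: t_def)
  \<comment> \<open>The equation defining the Lambert function is the fixed point equation for the density
    \<open>t a\<close>. At \<open>a = 0\<close> the quotient in \<open>t\<close> is meaningless, and the solution is \<open>Q\<close>.\<close>
  have t: "t a = Q * exp (- (a * \<beta> * t a))" if "a \<ge> 0" for a
  proof (cases "a = 0")
    case False
    then have a: "a > 0" using that by simp
    have "a * \<beta> * (t a * exp (w a)) = a * \<beta> * Q"
      using w(2)[OF a] wt[OF a] by (simp add: mult.assoc)
    then have "t a * exp (w a) = Q" using a assms by simp
    then show ?thesis unfolding wt[OF a, symmetric] by (simp add: exp_minus field_simps)
  qed (simp add: t_def)
  have lim: "p_CMF_N d \<beta> \<alpha> a \<longlonglongrightarrow> (a * \<beta> * (t a)\<^sup>2 / 2 + t a - Q) / \<beta>" if "a \<ge> 0" for a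
    unfolding Q_def by (rule p_CMF_N_tendsto[OF assms that t[OF that, unfolded Q_def]])
  then have p: "p_CMF d \<beta> \<alpha> a = (a * \<beta> * (t a)\<^sup>2 / 2 + t a - Q) / \<beta>" if "a \<ge> 0" for a
    unfolding p_CMF_def using that by (intro limI)
  have \<xi>: "\<xi>_CMF d \<beta> \<alpha> a = (\<lambda>k\<in>{1..}. exp (- (a * \<beta> * t a)) * q d \<beta> \<alpha> k)" if a: "a > 0" for a
  proof -
    have "w a / (a * \<beta> * Q) = exp (- w a)"
      using w[OF a] a Q assms by (simp add: exp_minus field_simps)
    then show ?thesis by (simp add: \<xi>_CMF_def Q_def[symmetric] w_def[symmetric] wt[OF a])
  qed
  have formula: "p_CMF_formula d \<beta> \<alpha> a = t a / \<beta> * (1 + w a / 2)" if a: "a > 0" for a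
    using a assms
    by (simp add: p_CMF_formula_def Q_def[symmetric] w_def[symmetric] t_def power2_eq_square)
  \<comment> \<open>As \<open>a\<close> decreases to \<open>0\<close>, the exponent \<open>w a\<close> vanishes and the density \<open>t a\<close> tends to \<open>Q\<close>.\<close>
  have w_le: "w a \<le> a * \<beta> * Q" if a: "a > 0" for a
    using w[OF a] mult_left_mono[of 1 "exp (w a)" "w a"] by simp
  have "((\<lambda>a. a * \<beta> * Q) \<longlongrightarrow> 0 * \<beta> * Q) (at_right 0)"
    by (intro tendsto_intros)
  then have upper: "((\<lambda>a. a * \<beta> * Q) \<longlongrightarrow> 0) (at_right 0)" by simp
  have "(w \<longlongrightarrow> 0) (at_right 0)"
    by (rule tendsto_sandwich[OF _ _ tendsto_const upper])
      (auto simp: eventually_at_filter w_le less_imp_le[OF w(1)])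
  then have "((\<lambda>a. Q * exp (- w a) / \<beta> * (1 + w a / 2)) \<longlongrightarrow> Q * exp (- 0) / \<beta> * (1 + 0 / 2)) (at_right 0)"
    using assms by (intro tendsto_intros) auto
  moreover have "\<forall>\<^sub>F a in at_right 0. Q * exp (- w a) / \<beta> * (1 + w a / 2) = p_CMF_formula d \<beta> \<alpha> a"
    using t wt by (auto simp: eventually_at_filter formula)
  ultimately have "(p_CMF_formula d \<beta> \<alpha> \<longlongrightarrow> Q * exp (- 0) / \<beta> * (1 + 0 / 2)) (at_right 0)"
    by (rule Lim_transform_eventually)
  then have limit: "(p_CMF_formula d \<beta> \<alpha> \<longlongrightarrow> Q / \<beta> + p_CMF d \<beta> \<alpha> 0) (at_right 0)"
    by (simp add: p t_def)
  have pressure: "Q / \<beta> + p_CMF d \<beta> \<alpha> a = p_CMF_formula d \<beta> \<alpha> a" if a: "a > 0" for a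
  proof -
    have "a * \<beta> * (t a)\<^sup>2 = w a * t a" by (simp add: wt[OF a] power2_eq_square)
    then have "p_CMF d \<beta> \<alpha> a = (w a * t a / 2 + t a - Q) / \<beta>"
      using a p by simp
    then show ?thesis
      by (simp add: formula[OF a] add_divide_distrib diff_divide_distrib ring_distribs mult.commute)
  qed
  show ?thesis
  proof (intro conjI allI impI)
    fix a :: real assume "a > 0"
    then show "{x \<in> ell1. I_CMF d \<beta> \<alpha> a x = 0} = {\<xi>_CMF d \<beta> \<alpha> a}"
      using I_CMF_zero_set[OF assms, of a "t a"] t[of a] \<xi>[of a] by (simp add: Q_def)
  next
    fix a :: real assume "a \<ge> 0"
    then show "p_CMF_N d \<beta> \<alpha> a \<longlonglongrightarrow> p_CMF d \<beta> \<alpha> a" using lim p by simp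
  qed (use pressure limit in \<open>auto simp: Q_def\<close>)
qed

end
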